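(* Let $F:\mathbb{R}^d\to\mathbb{R}$ be five times continuously differentiable with $\nabla^5F(\mathbf{x})\neq 0$ for all $\mathbf{x}\in\mathbb{R}^d$. Suppose there are constants $M>0$ and $m>0$ such that $\|\nabla F(\mathbf{x}_1)-\nabla F(\mathbf{x}_2)\|\le M\|\mathbf{x}_1-\mathbf{x}_2\|$ for all $\mathbf{x}_1,\mathbf{x}_2\in\mathbb{R}^d$, and such that the smallest eigenvalue of the Hessian $\nabla^2F(\mathbf{x})$ is at least $m$ for all $\mathbf{x}\in\mathbb{R}^d$. Let $\mathbf{x}^*$ be the unique minimizer of $F$. Let $\mathbf{x}_0\in\mathbb{R}^d$ be a deterministic initial point, and let $\mathbf{x}_{k+1}=\mathbf{x}_k-a_k\,g_k(\mathbf{x}_k)$ for $k\ge 0$, where $g_k(\mathbf{x}_k)$ is the stochastic gradient estimate at iteration $k$, with conditional bias $\boldsymbol{b}_k$ and noise $\boldsymbol{\epsilon}_k$. Suppose that for every $k\ge 0$, $$\max\left\{\mathbb{E}[\|\boldsymbol{b}_k\|^2\mid\mathcal{F}_k],\ \mathbb{E}[\|\boldsymbol{\epsilon}_k\|^2\mid\mathcal{F}_k]\right\}\le\theta^2\|\nabla F(\mathbf{x}_k)\|^2,$$ where $0<\theta<m/(2M)$. If $0<a_k=a\le \dfrac{1}{(2\theta^2+2\theta+1)M}$ for all $k\ge 0$, then for all $k\ge 0$ $$\mathbb{E}\left[\|\mathbf{x}_k-\mathbf{x}^*\|^2\right]\le\left(1-(m-2\theta M)a\right)^k\|\mathbf{x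}_0-\mathbf{x}^*\|^2.$$
   Context: $\|\cdot\|$ is the Euclidean norm. The problem is to minimize $F(\mathbf{x})=\mathbb{E}[f(\mathbf{x})]$ over $\mathbb{R}^d$, where only noisy evaluations $f(\mathbf{x})$ are available. At iteration $k$ the algorithm forms a random gradient estimate $g_k(\mathbf{x}_k)\in\mathbb{R}^d$ of $\nabla F(\mathbf{x}_k)$ from noisy function evaluations. (In the paper this is a batch-based central finite-difference estimate, the "Cor-CFD" estimate, using $n_k$ pairs of evaluations per coordinate; the statement refers to it only through the quantities below.) Let $\mathcal{F}_k=\sigma\{\mathbf{x}_1,\dots,\mathbf{x}_k\}$ be the $\sigma$-field generated by the iterates (trivial for $k=0$). The conditional bias and the noise are $$\boldsymbol{b}_k=\mathbb{E}[g_k(\mathbf{x}_k)\mid\mathcal{F}_k]-\nabla F(\mathbf{x}_k),\qquad \boldsymbol{\epsilon}_k=g_k(\mathbf{x}_k)-\mathbb{E}[g_k(\mathbf{x}_k)\mid\mathcal{F}_k].$$ *)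

theory Defs
  imports "HOL-Probability.Probability"
begin

text \<open>
  \<open>deriv_tensor F [v\<^sub>1, \<dots>, v\<^sub>k] x\<close> is the \<open>k\<close>-th derivative tensor of \<open>F\<close> at \<open>x\<close> applied to
  \<open>v\<^sub>1, \<dots>, v\<^sub>k\<close>. It has this meaning where the derivatives involved exist; \<open>frechet_derivative\<close> is
  otherwise unspecified.
\<close>

primrec deriv_tensor :: "(real ^ 'n \<Rightarrow> real) \<Rightarrow> (real ^ 'n) list \<Rightarrow> real ^ 'n \<Rightarrow> real" where
  "deriv_tensor F [] = F"
| "deriv_tensor F (v # vs) = (\<lambda>x. frechet_derivative (deriv_tensor F vs) (at x) v)"

definition times_cont_differentiable :: "nat \<Rightarrow> (real ^ 'n \<Rightarrow> real) \<Rightarrow> bool" where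
  "times_cont_differentiable k F \<longleftrightarrow>
     (\<forall>vs. length vs < k \<longrightarrow> (\<forall>x. deriv_tensor F vs differentiable (at x))) \<and>
     (\<forall>vs. length vs \<le> k \<longrightarrow> continuous_on UNIV (deriv_tensor F vs))"

definition deriv_tensor_nonzero :: "nat \<Rightarrow> (real ^ 'n \<Rightarrow> real) \<Rightarrow> real ^ 'n \<Rightarrow> bool" where
  "deriv_tensor_nonzero k F x \<longleftrightarrow> (\<exists>vs. length vs = k \<and> deriv_tensor F vs x \<noteq> 0)"

definition gradient :: "(real ^ 'n \<Rightarrow> real) \<Rightarrow> real ^ 'n \<Rightarrow> real ^ 'n" where
  "gradient F x = (THE D. GDERIV F x :> D)"

definition hessian :: "(real ^ 'n \<Rightarrow> real) \<Rightarrow> real ^ 'n \<Rightarrow> real ^ 'n ^ 'n" where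
  "hessian F x = jacobian (gradient F) (at x)"

definition eigenvalue :: "real ^ 'n ^ 'n \<Rightarrow> real \<Rightarrow> bool" where
  "eigenvalue A c \<longleftrightarrow> (\<exists>v. v \<noteq> 0 \<and> A *v v = c *\<^sub>R v)"

text \<open>
  Only used for symmetric matrices, for which the set of real eigenvalues is finite and nonempty.
\<close>

definition smallest_eigenvalue :: "real ^ 'n ^ 'n \<Rightarrow> real" where
  "smallest_eigenvalue A = Min {c. eigenvalue A c}"

text \<open>
  The \<open>\<sigma>\<close>-field generated by \<open>X 1, \<dots>, X k\<close>. The initial point \<open>X 0\<close> is left out, so that it is
  the trivial \<open>\<sigma>\<close>-field for \<open>k = 0\<close>.
\<close>

definition iterate_sigma :: "'w measure \<Rightarrow> (nat \<Rightarrow> 'w \<Rightarrow> real ^ 'n) \<Rightarrow> nat \<Rightarrow> 'w measure" where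
  "iterate_sigma P X k =
     sigma (space P) (\<Union>i\<in>{1..k}. {X i -` A \<inter> space P | A. A \<in> sets borel})"

text \<open>The library has conditional expectations of scalar functions only.\<close>

definition vec_cond_exp ::
  "'w measure \<Rightarrow> 'w measure \<Rightarrow> ('w \<Rightarrow> real ^ 'n) \<Rightarrow> 'w \<Rightarrow> real ^ 'n" where
  "vec_cond_exp P S G \<omega> = (\<chi> i. real_cond_exp P S (\<lambda>\<omega>. G \<omega> $ i) \<omega>)"

text \<open>
  In the following two definitions, \<open>g k x \<omega>\<close> is the random gradient estimate formed at iteration
  \<open>k\<close> at the point \<open>x\<close>.
\<close>

definition cond_bias :: "'w measure \<Rightarrow> (real ^ 'n \<Rightarrow> real) \<Rightarrow>
    (nat \<Rightarrow> real ^ 'n \<Rightarrow> 'w \<Rightarrow> real ^ 'n) \<Rightarrow> (nat \<Rightarrow> 'w \<Rightarrow> real ^ 'n) \<Rightarrow> nat \<Rightarrow> 'w \<Rightarrow> real ^ 'n" where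
  "cond_bias P F g X k \<omega> =
     vec_cond_exp P (iterate_sigma P X k) (\<lambda>\<omega>. g k (X k \<omega>) \<omega>) \<omega> - gradient F (X k \<omega>)"

definition grad_noise :: "'w measure \<Rightarrow>
    (nat \<Rightarrow> real ^ 'n \<Rightarrow> 'w \<Rightarrow> real ^ 'n) \<Rightarrow> (nat \<Rightarrow> 'w \<Rightarrow> real ^ 'n) \<Rightarrow> nat \<Rightarrow> 'w \<Rightarrow> real ^ 'n" where
  "grad_noise P g X k \<omega> =
     g k (X k \<omega>) \<omega> - vec_cond_exp P (iterate_sigma P X k) (\<lambda>\<omega>. g k (X k \<omega>) \<omega>) \<omega>"

end

theory Submission
  imports Defs
begin

text \<open>
  Write \<open>y\<^sub>k = x\<^sub>k - x\<^sup>*\<close> and let \<open>h\<^sub>k = \<nabla>F(x\<^sub>k) + b\<^sub>k\<close> be the conditional expectation of the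
  gradient estimate, so that \<open>y\<^sub>k\<^sub>+\<^sub>1 = (y\<^sub>k - a h\<^sub>k) - a \<epsilon>\<^sub>k\<close>. The bracket is measurable with
  respect to the past, hence orthogonal in mean to the noise, and
  \<open>E|y\<^sub>k\<^sub>+\<^sub>1|\<^sup>2 = E|y\<^sub>k - a h\<^sub>k|\<^sup>2 + a\<^sup>2 E|\<epsilon>\<^sub>k|\<^sup>2 \<le> E(|y\<^sub>k - a h\<^sub>k|\<^sup>2 + a\<^sup>2 \<theta>\<^sup>2 |\<nabla>F(x\<^sub>k)|\<^sup>2)\<close>.
  The bias is itself measurable with respect to the past, so its conditional bound is the pointwise
  bound \<open>|b\<^sub>k| \<le> \<theta> |\<nabla>F(x\<^sub>k)|\<close>.

  What remains is a deterministic inequality (\<open>biased_gradient_step_contracts\<close>). Expanding the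
  square, the terms quadratic in \<open>a\<close> are at most \<open>a\<^sup>2 (2\<theta>\<^sup>2 + 2\<theta> + 1) |\<nabla>F|\<^sup>2\<close>, which by the step
  size bound is at most \<open>(a / M) |\<nabla>F|\<^sup>2\<close>. Cocoercivity of the gradient, \<open>|\<nabla>F|\<^sup>2 \<le> M y \<bullet> \<nabla>F\<close>, lets
  half of the descent term \<open>2a y \<bullet> \<nabla>F\<close> absorb this; strong monotonicity \<open>y \<bullet> \<nabla>F \<ge> m |y|\<^sup>2\<close> turns
  the other half into the contraction \<open>- a m |y|\<^sup>2\<close>, and the bias costs at most \<open>2a\<theta>M |y|\<^sup>2\<close>.

  Strong monotonicity comes from the Hessian: second derivatives commute (\<open>deriv_tensor_swap\<close>), so
  the Hessian is symmetric and its smallest eigenvalue bounds its quadratic form from below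
  (\<open>smallest_eigenvalue_le_form\<close>); the mean value theorem along segments does the rest.
  Cocoercivity (\<open>cocoercive_gradient\<close>) is the Baillon--Haddad theorem.

  No integrability of the estimates is assumed. It is obtained inductively: if \<open>y\<^sub>k\<close> is square
  integrable, so is \<open>\<nabla>F(x\<^sub>k)\<close> by the Lipschitz condition, hence so are \<open>b\<^sub>k\<close> and \<open>\<epsilon>\<^sub>k\<close> by their
  conditional bounds, and therefore \<open>g\<^sub>k\<close> and \<open>y\<^sub>k\<^sub>+\<^sub>1\<close>.
\<close>

section \<open>Gradients and iterated derivatives\<close>

lemma GDERIV_gradient:
  assumes "F differentiable (at x)"
  shows "GDERIV F x :> gradient F x"
proof -
  obtain D where D: "(F has_derivative D) (at x)"
    using assms by (auto simp: differentiable_def)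
  have "h \<bullet> adjoint D 1 = D h" for h
    using adjoint_works[OF has_derivative_linear[OF D], of h 1] by simp
  then have ex: "GDERIV F x :> adjoint D 1"
    using D by (simp add: gderiv_def)
  have unique: "E = E'" if "GDERIV F x :> E" "GDERIV F x :> E'" for E E'
  proof -
    have "(\<lambda>h. h \<bullet> E) = (\<lambda>h. h \<bullet> E')"
      using that has_derivative_unique unfolding gderiv_def by blast
    then show ?thesis
      by (metis vector_eq_ldot)
  qed
  show ?thesis
    unfolding gradient_def by (rule theI) (rule ex, rule unique[OF _ ex])
qed

lemma deriv_tensor_Cons_eqI:
  assumes "(deriv_tensor F vs has_derivative D) (at x)"
  shows "deriv_tensor F (v # vs) x = D v"
  using frechet_derivative_at[OF assms] by simp

lemma inner_gradient:
  assumes "F differentiable (at x)"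
  shows "v \<bullet> gradient F x = deriv_tensor F [v] x"
  using deriv_tensor_Cons_eqI[of F "[]" "\<lambda>h. h \<bullet> gradient F x" x v] GDERIV_gradient[OF assms]
  by (simp add: gderiv_def)

lemma times_cont_differentiable_mono:
  "times_cont_differentiable k F \<Longrightarrow> j \<le> k \<Longrightarrow> times_cont_differentiable j F"
  unfolding times_cont_differentiable_def by auto

lemma times_cont_differentiableD:
  assumes "times_cont_differentiable k F"
  shows "length vs < k \<Longrightarrow> deriv_tensor F vs differentiable (at x)"
    and "length vs \<le> k \<Longrightarrow> isCont (deriv_tensor F vs) x"
  using assms unfolding times_cont_differentiable_def
  by (auto simp: continuous_on_eq_continuous_at)

lemma has_real_derivative_along_line:
  fixes f :: "'a::real_normed_vector \<Rightarrow> real"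
  assumes "(f has_derivative D) (at (x + t *\<^sub>R v))"
  shows "((\<lambda>t. f (x + t *\<^sub>R v)) has_real_derivative D v) (at t)"
proof -
  have "((\<lambda>t. x + t *\<^sub>R v) has_derivative (\<lambda>h. h *\<^sub>R v)) (at t)"
    by (auto intro!: derivative_eq_intros)
  from has_derivative_compose[OF this assms]
  have "((\<lambda>t. f (x + t *\<^sub>R v)) has_derivative (\<lambda>h. D (h *\<^sub>R v))) (at t)" .
  moreover have "(\<lambda>h. D (h *\<^sub>R v)) = (*) (D v)"
    using linear_scale[OF has_derivative_linear[OF assms]] by (auto simp: fun_eq_iff)
  ultimately show ?thesis
    by (simp add: has_field_derivative_def)
qed

lemma deriv_tensor_along_line:
  assumes "deriv_tensor F vs differentiable (at (x + t *\<^sub>R v))"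
  shows "((\<lambda>t. deriv_tensor F vs (x + t *\<^sub>R v)) has_real_derivative
           deriv_tensor F (v # vs) (x + t *\<^sub>R v)) (at t)"
  using has_real_derivative_along_line[of "deriv_tensor F vs"] assms
  unfolding frechet_derivative_works by auto

section \<open>Symmetry of second derivatives\<close>

text \<open>
  Two applications of the mean value theorem, first in the direction \<open>u\<close> and then in the direction
  \<open>v\<close>. The left-hand side of the equation is symmetric in \<open>u\<close> and \<open>v\<close>, the right-hand side is not.
\<close>

lemma second_difference_mean_value:
  assumes F: "times_cont_differentiable 2 F" and t: "t > 0"
  shows "\<exists>z. norm (z - x) \<le> t * (norm u + norm v) \<and>
    F (x + t *\<^sub>R u + t *\<^sub>R v) - F (x + t *\<^sub>R u) - F (x + t *\<^sub>R v) + F x =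
      t\<^sup>2 * deriv_tensor F [v, u] z"
proof -
  let ?D = "deriv_tensor F [u]"
  note diff = times_cont_differentiableD(1)[OF F]
  define \<psi> where "\<psi> s = F (x + t *\<^sub>R v + s *\<^sub>R u) - F (x + s *\<^sub>R u)" for s
  have "(\<psi> has_real_derivative ?D (x + t *\<^sub>R v + s *\<^sub>R u) - ?D (x + s *\<^sub>R u)) (at s)" for s
    unfolding \<psi>_def
    using deriv_tensor_along_line[of F "[]"] diff[of "[]"]
    by (intro DERIV_diff) auto
  from MVT2[OF t this] obtain p where p: "0 < p" "p < t"
    "\<psi> t - \<psi> 0 = t * (?D (x + t *\<^sub>R v + p *\<^sub>R u) - ?D (x + p *\<^sub>R u))"
    by auto
  define \<phi> where "\<phi> r = ?D (x + p *\<^sub>R u + r *\<^sub>R v)" for r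
  have "(\<phi> has_real_derivative deriv_tensor F [v, u] (x + p *\<^sub>R u + r *\<^sub>R v)) (at r)" for r
    unfolding \<phi>_def
    by (rule deriv_tensor_along_line) (simp add: diff del: deriv_tensor.simps)
  from MVT2[OF t this] obtain q where q: "0 < q" "q < t"
    "\<phi> t - \<phi> 0 = t * deriv_tensor F [v, u] (x + p *\<^sub>R u + q *\<^sub>R v)"
    by auto
  have "\<psi> t - \<psi> 0 = t * (\<phi> t - \<phi> 0)"
    using p(3) by (simp add: \<phi>_def add_ac del: deriv_tensor.simps)
  also have "\<dots> = t\<^sup>2 * deriv_tensor F [v, u] (x + p *\<^sub>R u + q *\<^sub>R v)"
    by (simp only: q(3) power2_eq_square mult.assoc)
  finally have "F (x + t *\<^sub>R u + t *\<^sub>R v) - F (x + t *\<^sub>R u) - F (x + t *\<^sub>R v) + F x =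
      t\<^sup>2 * deriv_tensor F [v, u] (x + p *\<^sub>R u + q *\<^sub>R v)"
    by (simp add: \<psi>_def add_ac del: deriv_tensor.simps)
  moreover have "norm (x + p *\<^sub>R u + q *\<^sub>R v - x) \<le> t * (norm u + norm v)"
  proof -
    have "norm (p *\<^sub>R u + q *\<^sub>R v) \<le> p * norm u + q * norm v"
      using norm_triangle_ineq[of "p *\<^sub>R u" "q *\<^sub>R v"] p(1) q(1) by simp
    also have "\<dots> \<le> t * norm u + t * norm v"
      using p(2) q(2) by (intro add_mono mult_right_mono) auto
    finally show ?thesis
      by (simp add: distrib_left add.assoc)
  qed
  ultimately show ?thesis
    by blast
qed

lemma second_difference_tendsto:
  assumes F: "times_cont_differentiable 2 F"
  shows "((\<lambda>t. (F (x + t *\<^sub>R u + t *\<^sub>R v) - F (x + t *\<^sub>R u) - F (x + t *\<^sub>R v) + F x) / t\<^sup>2)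
           \<longlongrightarrow> deriv_tensor F [v, u] x) (at_right 0)"
proof -
  let ?D = "deriv_tensor F [v, u]"
  let ?\<Delta> = "\<lambda>t. F (x + t *\<^sub>R u + t *\<^sub>R v) - F (x + t *\<^sub>R u) - F (x + t *\<^sub>R v) + F x"
  have "\<forall>t\<in>{0<..}. \<exists>z. norm (z - x) \<le> t * (norm u + norm v) \<and> ?\<Delta> t = t\<^sup>2 * ?D z"
    by (intro ballI second_difference_mean_value[OF F]) simp
  from bchoice[OF this] obtain z where
    z: "\<And>t. t > 0 \<Longrightarrow> norm (z t - x) \<le> t * (norm u + norm v) \<and> ?\<Delta> t = t\<^sup>2 * ?D (z t)"
    by (auto simp del: deriv_tensor.simps)
  have ev: "\<forall>\<^sub>F t in at_right (0::real). 0 < t"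
    by (simp add: eventually_at_filter)
  have "((\<lambda>t. z t - x) \<longlongrightarrow> 0) (at_right 0)"
  proof (rule Lim_null_comparison)
    show "\<forall>\<^sub>F t in at_right 0. norm (z t - x) \<le> t * (norm u + norm v)"
      using ev by (rule eventually_mono) (simp only: z)
    show "((\<lambda>t. t * (norm u + norm v)) \<longlongrightarrow> 0) (at_right 0)"
      by (auto intro!: tendsto_eq_intros)
  qed
  then have "(z \<longlongrightarrow> x) (at_right 0)"
    by (rule LIM_zero_cancel)
  then have "((\<lambda>t. ?D (z t)) \<longlongrightarrow> ?D x) (at_right 0)"
    by (intro isCont_tendsto_compose[of x ?D] times_cont_differentiableD(2)[OF F]) simp_all
  then show ?thesis
  proof (rule Lim_transform_eventually)
    show "\<forall>\<^sub>F t in at_right 0. ?D (z t) =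
        ?\<Delta> t / t\<^sup>2"
    proof (rule eventually_mono[OF ev])
      fix t :: real
      assume "0 < t"
      then show "?D (z t) =
          ?\<Delta> t / t\<^sup>2"
        using z[of t] by (simp del: deriv_tensor.simps)
    qed
  qed
qed

lemma deriv_tensor_swap:
  assumes F: "times_cont_differentiable 2 F"
  shows "deriv_tensor F [v, u] x = deriv_tensor F [u, v] x"
proof -
  have swap: "F (x + t *\<^sub>R u + t *\<^sub>R v) - F (x + t *\<^sub>R u) - F (x + t *\<^sub>R v) + F x =
      F (x + t *\<^sub>R v + t *\<^sub>R u) - F (x + t *\<^sub>R v) - F (x + t *\<^sub>R u) + F x" for t
    by (simp add: add.assoc add.commute[of "t *\<^sub>R u"])
  show ?thesis
    using trivial_limit_at_right_real second_difference_tendsto[OF F, of x u v, unfolded swap]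
      second_difference_tendsto[OF F, of x v u]
    by (rule tendsto_unique)
qed

section \<open>The Hessian and its smallest eigenvalue\<close>

lemma gradient_has_derivative_hessian:
  assumes F: "times_cont_differentiable 2 F"
  shows "(gradient F has_derivative (\<lambda>h. hessian F x *v h)) (at x)"
proof -
  have eq: "(\<lambda>x. gradient F x \<bullet> v) = deriv_tensor F [v]" for v
    using inner_gradient[of F] times_cont_differentiableD(1)[OF F, of "[]"]
    by (auto simp: fun_eq_iff inner_commute simp del: deriv_tensor.simps(2))
  have "(\<lambda>x. gradient F x \<bullet> v) differentiable (at x)" for v
    unfolding eq using times_cont_differentiableD(1)[OF F, of "[v]"] by simp
  then have "gradient F differentiable (at x)"
    by (subst differentiable_componentwise_within) blast
  then show ?thesis
    unfolding hessian_def by (subst (asm) jacobian_works)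
qed

lemma inner_hessian:
  assumes F: "times_cont_differentiable 2 F"
  shows "v \<bullet> (hessian F x *v w) = deriv_tensor F [w, v] x"
proof -
  have "deriv_tensor F [v] = (\<lambda>x. v \<bullet> gradient F x)"
    using inner_gradient[of F] times_cont_differentiableD(1)[OF F, of "[]"]
    by (auto simp: fun_eq_iff simp del: deriv_tensor.simps(2))
  moreover have "((\<lambda>x. v \<bullet> gradient F x) has_derivative (\<lambda>h. v \<bullet> (hessian F x *v h))) (at x)"
    by (intro has_derivative_inner_right gradient_has_derivative_hessian F)
  ultimately show ?thesis
    by (intro deriv_tensor_Cons_eqI[symmetric]) simp
qed

lemma hessian_symmetric:
  assumes "times_cont_differentiable 2 F"
  shows "transpose (hessian F x) = hessian F x"
proof -
  let ?H = "hessian F x"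
  have "v \<bullet> (transpose ?H *v w) = v \<bullet> (?H *v w)" for v w
  proof -
    have "v \<bullet> (transpose ?H *v w) = w \<bullet> (?H *v v)"
      by (simp add: transpose_matrix_vector dot_lmul_matrix inner_commute[of v])
    also have "\<dots> = v \<bullet> (?H *v w)"
      unfolding inner_hessian[OF assms] by (rule deriv_tensor_swap[OF assms])
    finally show ?thesis .
  qed
  then have "transpose ?H *v w = ?H *v w" for w
    using vector_eq_ldot by blast
  then show ?thesis
    by (simp add: matrix_eq)
qed

lemma symmetric_inner:
  fixes A :: "real ^ 'n ^ 'n"
  assumes "transpose A = A"
  shows "v \<bullet> (A *v w) = w \<bullet> (A *v v)"
  using dot_lmul_matrix[of v A w] transpose_matrix_vector[of A v] assms
  by (simp add: inner_commute)

text \<open>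
  Eigenvectors of a symmetric matrix for distinct eigenvalues are orthogonal, hence independent.
\<close>

lemma finite_eigenvalues_symmetric:
  fixes A :: "real ^ 'n ^ 'n"
  assumes A: "transpose A = A"
  shows "finite {c. eigenvalue A c}"
proof -
  let ?E = "{c. eigenvalue A c}"
  have "\<forall>c\<in>?E. \<exists>v. v \<noteq> 0 \<and> A *v v = c *\<^sub>R v"
    by (simp add: eigenvalue_def)
  from bchoice[OF this] obtain e
    where e: "\<And>c. c \<in> ?E \<Longrightarrow> e c \<noteq> 0 \<and> A *v e c = c *\<^sub>R e c"
    by blast
  have orth: "e c \<bullet> e d = 0" if "c \<in> ?E" "d \<in> ?E" "c \<noteq> d" for c d
    using symmetric_inner[OF A, of "e c" "e d"] e[OF that(1)] e[OF that(2)] that(3)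
    by (simp add: inner_commute)
  have "inj_on e ?E"
  proof (rule inj_onI)
    fix c d assume cd: "c \<in> ?E" "d \<in> ?E" "e c = e d"
    show "c = d"
    proof (rule ccontr)
      assume "c \<noteq> d"
      from orth[OF cd(1,2) this] cd(3) e[OF cd(1)] show False
        by simp
    qed
  qed
  moreover have "independent (e ` ?E)"
    by (rule pairwise_orthogonal_independent)
       (use e in \<open>auto simp: pairwise_def orthogonal_def intro!: orth\<close>)
  ultimately show ?thesis
    using finiteI_independent finite_imageD by blast
qed

text \<open>
  A positive semidefinite form that vanishes at \<open>v\<close> is minimal there. If \<open>w = B v\<close> were nonzero,
  a suitable step from \<open>v\<close> in the direction \<open>- w\<close> would make the form negative.
\<close>

lemma psd_zero_form_imp_kernel:
  fixes B :: "real ^ 'n ^ 'n"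
  assumes B: "transpose B = B" and psd: "\<And>w. 0 \<le> w \<bullet> (B *v w)" and v: "v \<bullet> (B *v v) = 0"
  shows "B *v v = 0"
proof (rule ccontr)
  assume "B *v v \<noteq> 0"
  define w where "w = B *v v"
  define n where "n = w \<bullet> w"
  define C where "C = w \<bullet> (B *v w)"
  \<comment> \<open>The form at \<open>v + t w\<close> is \<open>2 t n + t\<^sup>2 C\<close>. Its minimizer would be \<open>- n / C\<close>; adding \<open>1\<close>
    to the denominator covers the case \<open>C = 0\<close>.\<close>
  define t where "t = - n / (C + 1)"
  have n: "n > 0" and C: "C \<ge> 0"
    using \<open>B *v v \<noteq> 0\<close> psd by (auto simp: n_def C_def w_def)
  have tC: "t * C = - n - t" and "t < 0"
    using n C by (simp_all add: t_def field_simps)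
  have "0 \<le> (v + t *\<^sub>R w) \<bullet> (B *v (v + t *\<^sub>R w))"
    by (rule psd)
  also have "\<dots> = 2 * t * n + t\<^sup>2 * C"
    using symmetric_inner[OF B, of v w] v
    by (simp add: matrix_vector_right_distrib matrix_vector_mult_scaleR inner_simps
        n_def C_def power2_eq_square flip: w_def) (simp add: w_def algebra_simps)
  also have "\<dots> = t * (n - t)"
  proof -
    have "2 * t * n + t\<^sup>2 * C = t * (2 * n + t * C)"
      by (simp add: power2_eq_square algebra_simps)
    then show ?thesis
      unfolding tC by simp
  qed
  also have "\<dots> < 0"
    using n \<open>t < 0\<close> by (intro mult_neg_pos) auto
  finally show False
    by simp
qed

text \<open>
  The minimum \<open>c\<close> of the quadratic form over the unit sphere is an eigenvalue: the form of
  \<open>A - c I\<close> is positive semidefinite and vanishes at a minimizer.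
\<close>

lemma smallest_eigenvalue_le_form:
  fixes A :: "real ^ 'n ^ 'n"
  assumes A: "transpose A = A"
  shows "smallest_eigenvalue A * (norm v)\<^sup>2 \<le> v \<bullet> (A *v v)"
proof -
  have "compact (sphere 0 1 :: (real ^ 'n) set)" "sphere 0 1 \<noteq> ({} :: (real ^ 'n) set)"
    by simp_all
  moreover have "continuous_on (sphere 0 1) (\<lambda>v. v \<bullet> (A *v v))"
    by (intro continuous_intros linear_continuous_on matrix_vector_mul_bounded_linear)
  ultimately obtain e where e: "norm e = 1"
    and min: "\<And>v. norm v = 1 \<Longrightarrow> e \<bullet> (A *v e) \<le> v \<bullet> (A *v v)"
    using continuous_attains_inf[of "sphere 0 1 :: (real ^ 'n) set" "\<lambda>v. v \<bullet> (A *v v)"]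
    by auto
  define c where "c = e \<bullet> (A *v e)"
  have form: "c * (norm v)\<^sup>2 \<le> v \<bullet> (A *v v)" for v
  proof (cases "v = 0")
    case False
    have "c \<le> sgn v \<bullet> (A *v sgn v)"
      unfolding c_def by (rule min) (simp add: False norm_sgn)
    also have "\<dots> = (v \<bullet> (A *v v)) / (norm v)\<^sup>2"
      by (simp add: sgn_div_norm matrix_vector_mult_scaleR power2_eq_square divide_simps)
    finally show ?thesis
      using False by (simp add: field_simps)
  qed simp
  define B where "B = A - c *\<^sub>R mat 1"
  have Bv: "B *v v = A *v v - c *\<^sub>R v" for v
    by (simp add: B_def matrix_vector_mult_diff_rdistrib flip: scaleR_matrix_vector_assoc)
  have "B *v e = 0"
  proof (rule psd_zero_form_imp_kernel)
    show "transpose B = B"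
      using A by (simp add: B_def transpose_def vec_eq_iff mat_def)
    show "0 \<le> w \<bullet> (B *v w)" for w
      using form[of w] by (simp add: Bv inner_simps power2_norm_eq_inner)
    show "e \<bullet> (B *v e) = 0"
      using e by (simp add: Bv inner_simps c_def flip: power2_norm_eq_inner)
  qed
  then have "eigenvalue A c"
    unfolding eigenvalue_def Bv using e by (intro exI[of _ e]) auto
  then have "smallest_eigenvalue A \<le> c"
    unfolding smallest_eigenvalue_def using finite_eigenvalues_symmetric[OF A] by simp
  then show ?thesis
    using order_trans[OF mult_right_mono form[of v]] by simp
qed

section \<open>Strong monotonicity and cocoercivity of the gradient\<close>

lemma strongly_monotone_gradient:
  assumes F: "times_cont_differentiable 2 F"
    and eig: "\<And>x. m \<le> smallest_eigenvalue (hessian F x)"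
  shows "m * (norm (x - y))\<^sup>2 \<le> (x - y) \<bullet> (gradient F x - gradient F y)"
proof -
  let ?v = "x - y"
  have "((\<lambda>t. ?v \<bullet> gradient F (y + t *\<^sub>R ?v)) has_real_derivative
      ?v \<bullet> (hessian F (y + t *\<^sub>R ?v) *v ?v)) (at t)" for t
    by (rule has_real_derivative_along_line)
       (intro has_derivative_inner_right gradient_has_derivative_hessian F)
  from MVT2[OF zero_less_one this] obtain t
    where "?v \<bullet> gradient F x - ?v \<bullet> gradient F y = ?v \<bullet> (hessian F (y + t *\<^sub>R ?v) *v ?v)"
    by auto
  moreover have "m * (norm ?v)\<^sup>2 \<le> \<dots>"
    using order_trans[OF mult_right_mono[OF eig]
        smallest_eigenvalue_le_form[OF hessian_symmetric[OF F]]]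
    by simp
  ultimately show ?thesis
    by (simp add: inner_diff_right)
qed

lemma monotone_gradient_above_tangent:
  fixes G :: "'a::real_inner \<Rightarrow> 'a"
  assumes F: "\<And>x. GDERIV F x :> G x" and mono: "\<And>x y. 0 \<le> (x - y) \<bullet> (G x - G y)"
  shows "F x + (y - x) \<bullet> G x \<le> F y"
proof -
  let ?v = "y - x"
  have "((\<lambda>t. F (x + t *\<^sub>R ?v)) has_real_derivative ?v \<bullet> G (x + t *\<^sub>R ?v)) (at t)" for t
    by (rule has_real_derivative_along_line) (use F in \<open>simp add: gderiv_def\<close>)
  from MVT2[OF zero_less_one this] obtain t
    where t: "0 < t" "F y - F x = ?v \<bullet> G (x + t *\<^sub>R ?v)"
    by auto
  have "0 \<le> t * (?v \<bullet> G (x + t *\<^sub>R ?v) - ?v \<bullet> G x)"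
    using mono[of "x + t *\<^sub>R ?v" x] by (simp add: inner_diff_right right_diff_distrib)
  with t show ?thesis
    by (simp add: zero_le_mult_iff)
qed

lemma lipschitz_gradient_below_quadratic:
  fixes G :: "'a::real_inner \<Rightarrow> 'a"
  assumes F: "\<And>x. GDERIV F x :> G x" and lip: "\<And>x y. norm (G x - G y) \<le> M * norm (x - y)"
  shows "F y \<le> F x + (y - x) \<bullet> G x + M / 2 * (norm (y - x))\<^sup>2"
proof -
  let ?v = "y - x"
  define q where "q t = F (x + t *\<^sub>R ?v) - t * (?v \<bullet> G x) - M / 2 * (norm ?v)\<^sup>2 * t\<^sup>2" for t
  have deriv: "(q has_real_derivative
      ?v \<bullet> G (x + t *\<^sub>R ?v) - ?v \<bullet> G x - M * (norm ?v)\<^sup>2 * t) (at t)" for t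
  proof -
    have "((\<lambda>t. F (x + t *\<^sub>R ?v)) has_real_derivative ?v \<bullet> G (x + t *\<^sub>R ?v)) (at t)"
      by (rule has_real_derivative_along_line) (use F in \<open>simp add: gderiv_def\<close>)
    then show ?thesis
      unfolding q_def by (auto intro!: derivative_eq_intros)
  qed
  have nonpos: "?v \<bullet> G (x + t *\<^sub>R ?v) - ?v \<bullet> G x - M * (norm ?v)\<^sup>2 * t \<le> 0" if "t \<ge> 0" for t
  proof -
    have "?v \<bullet> (G (x + t *\<^sub>R ?v) - G x) \<le> norm ?v * norm (G (x + t *\<^sub>R ?v) - G x)"
      by (rule norm_cauchy_schwarz)
    also have "\<dots> \<le> norm ?v * (M * norm (t *\<^sub>R ?v))"
      using lip[of "x + t *\<^sub>R ?v" x] by (intro mult_left_mono) auto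
    finally show ?thesis
      using that by (simp add: inner_diff_right power2_eq_square mult_ac)
  qed
  have "q 1 \<le> q 0"
    by (rule DERIV_nonpos_imp_nonincreasing[OF zero_le_one]) (use deriv nonpos in blast)
  then show ?thesis
    by (simp add: q_def)
qed

text \<open>
  The Baillon--Haddad theorem. For fixed \<open>x\<close>, the convex function \<open>F - (\<lambda>z. z \<bullet> G x)\<close> is minimal at
  \<open>x\<close>, and a gradient step of length \<open>1 / M\<close> from \<open>y\<close> decreases it by at least
  \<open>|G y - G x|\<^sup>2 / (2M)\<close>. Adding the resulting inequality to the one with \<open>x\<close> and \<open>y\<close> exchanged
  gives the claim.
\<close>

lemma cocoercive_gradient:
  fixes G :: "'a::real_inner \<Rightarrow> 'a"
  assumes F: "\<And>x. GDERIV F x :> G x" and mono: "\<And>x y. 0 \<le> (x - y) \<bullet> (G x - G y)"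
    and lip: "\<And>x y. norm (G x - G y) \<le> M * norm (x - y)" and M: "M > 0"
  shows "(norm (G x - G y))\<^sup>2 \<le> M * ((x - y) \<bullet> (G x - G y))"
proof -
  have key: "F x + (y - x) \<bullet> G x + (norm (G y - G x))\<^sup>2 / (2 * M) \<le> F y" for x y
  proof -
    define d where "d = G y - G x"
    define z where "z = y - (1 / M) *\<^sub>R d"
    have "F x + (z - x) \<bullet> G x \<le> F z"
      by (rule monotone_gradient_above_tangent[OF F mono])
    also have "\<dots> \<le> F y + (z - y) \<bullet> G y + M / 2 * (norm (z - y))\<^sup>2"
      by (rule lipschitz_gradient_below_quadratic[OF F lip])
    finally have "F x + (z - x) \<bullet> G x \<le> F y + (z - y) \<bullet> G y + M / 2 * (norm (z - y))\<^sup>2" .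
    moreover have "(z - x) \<bullet> G x = (y - x) \<bullet> G x - d \<bullet> G x / M"
      "(z - y) \<bullet> G y = - (d \<bullet> G y / M)"
      by (simp_all add: z_def inner_simps)
    moreover have "M / 2 * (norm (z - y))\<^sup>2 = (norm d)\<^sup>2 / (2 * M)"
      using M by (simp add: z_def power_mult_distrib power2_eq_square divide_simps)
    moreover have "d \<bullet> G y / M - d \<bullet> G x / M = (norm d)\<^sup>2 / M"
      by (simp add: power2_norm_eq_inner d_def inner_simps diff_divide_distrib)
    ultimately have "F x + (y - x) \<bullet> G x + ((norm d)\<^sup>2 / M - (norm d)\<^sup>2 / (2 * M)) \<le> F y"
      by linarith
    then show ?thesis
      by (simp add: d_def)
  qed
  have "(norm (G x - G y))\<^sup>2 / (2 * M) + (norm (G x - G y))\<^sup>2 / (2 * M)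
      \<le> (x - y) \<bullet> (G x - G y)"
    using key[of x y] key[of y x] norm_minus_commute[of "G x" "G y"]
    by (simp add: inner_diff_left inner_diff_right)
  then show ?thesis
    using M by (simp add: field_simps)
qed

text \<open>
  Here \<open>y\<close> stands for the displacement from the minimizer, \<open>d\<close> for the gradient and \<open>b\<close> for the bias; the
  second summand on the left is the contribution of the noise.
\<close>

lemma biased_gradient_step_contracts:
  fixes y d b :: "'a::real_inner"
  assumes "0 < a" "a * ((2 * \<theta>\<^sup>2 + 2 * \<theta> + 1) * M) \<le> 1" "0 \<le> \<theta>" "0 \<le> m"
    and coco: "(norm d)\<^sup>2 \<le> M * (y \<bullet> d)" and strong: "m * (norm y)\<^sup>2 \<le> y \<bullet> d"
    and lip: "norm d \<le> M * norm y" and b: "norm b \<le> \<theta> * norm d"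
  shows "(norm (y - a *\<^sub>R (d + b)))\<^sup>2 + a\<^sup>2 * (\<theta>\<^sup>2 * (norm d)\<^sup>2)
           \<le> (1 - (m - 2 * \<theta> * M) * a) * (norm y)\<^sup>2"
proof -
  define Q where "Q = 2 * \<theta>\<^sup>2 + 2 * \<theta> + 1"
  have Q: "0 < Q" "a * (Q * M) \<le> 1"
    using assms by (auto simp: Q_def add_nonneg_pos)
  have expand: "(norm (y - a *\<^sub>R (d + b)))\<^sup>2
      = (norm y)\<^sup>2 - 2 * a * (y \<bullet> d) - 2 * a * (y \<bullet> b) + a\<^sup>2 * (norm (d + b))\<^sup>2"
    unfolding power2_norm_eq_inner by (simp add: inner_simps inner_commute power2_eq_square algebra_simps)
  have "- (y \<bullet> b) \<le> norm y * norm b"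
    using norm_cauchy_schwarz[of y "- b"] by simp
  also have "\<dots> \<le> norm y * (\<theta> * (M * norm y))"
    using order_trans[OF b mult_left_mono[OF lip \<open>0 \<le> \<theta>\<close>]] by (rule mult_left_mono) simp
  finally have "2 * a * - (y \<bullet> b) \<le> 2 * a * (norm y * (\<theta> * (M * norm y)))"
    using \<open>0 < a\<close> by (intro mult_left_mono) auto
  then have bias: "- 2 * a * (y \<bullet> b) \<le> 2 * \<theta> * M * a * (norm y)\<^sup>2"
    by (simp add: power2_eq_square mult_ac)
  have "norm (d + b) \<le> (1 + \<theta>) * norm d"
    using norm_triangle_ineq[of d b] b by (simp add: algebra_simps)
  then have "(norm (d + b))\<^sup>2 \<le> (1 + \<theta>)\<^sup>2 * (norm d)\<^sup>2"
    using power_mono[of "norm (d + b)" _ 2] by (simp flip: power_mult_distrib)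
  then have "a\<^sup>2 * (norm (d + b))\<^sup>2 \<le> a\<^sup>2 * ((1 + \<theta>)\<^sup>2 * (norm d)\<^sup>2)"
    by (intro mult_left_mono) auto
  then have "a\<^sup>2 * (norm (d + b))\<^sup>2 + a\<^sup>2 * (\<theta>\<^sup>2 * (norm d)\<^sup>2) \<le> a\<^sup>2 * (Q * (norm d)\<^sup>2)"
    by (simp add: Q_def power2_eq_square algebra_simps)
  also have "\<dots> \<le> a\<^sup>2 * (Q * (M * (y \<bullet> d)))"
    using coco Q by (intro mult_left_mono) auto
  also have "\<dots> = a * ((a * (Q * M)) * (y \<bullet> d))"
    by (simp add: power2_eq_square mult_ac)
  also have "\<dots> \<le> a * (1 * (y \<bullet> d))"
    using order_trans[OF _ strong, of 0] assms(1,4) Q(2)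
    by (intro mult_left_mono mult_right_mono) auto
  finally have "a\<^sup>2 * (norm (d + b))\<^sup>2 + a\<^sup>2 * (\<theta>\<^sup>2 * (norm d)\<^sup>2) \<le> a * (y \<bullet> d)"
    by simp
  moreover have "a * (m * (norm y)\<^sup>2) \<le> a * (y \<bullet> d)"
    using strong \<open>0 < a\<close> by (intro mult_left_mono) auto
  ultimately show ?thesis
    unfolding expand using bias by (simp add: algebra_simps)
qed

section \<open>The filtration generated by the iterates\<close>

lemma space_iterate_sigma [simp]: "space (iterate_sigma P X k) = space P"
  unfolding iterate_sigma_def by (rule space_measure_of) auto

lemma sets_iterate_sigma:
  "sets (iterate_sigma P X k) =
     sigma_sets (space P) (\<Union>i\<in>{1..k}. {X i -` A \<inter> space P | A. A \<in> sets borel})"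
  unfolding iterate_sigma_def by (rule sets_measure_of) auto

lemma subalgebra_iterate_sigma:
  assumes "\<And>i. X i \<in> borel_measurable P"
  shows "subalgebra P (iterate_sigma P X k)"
  unfolding subalgebra_def sets_iterate_sigma
  using measurable_sets[OF assms] by (auto intro!: sets.sigma_sets_subset)

lemma iterate_measurable_iterate_sigma:
  fixes X :: "nat \<Rightarrow> 'a \<Rightarrow> real ^ 'n"
  assumes "i \<in> {1..k}"
  shows "X i \<in> borel_measurable (iterate_sigma P X k)"
proof (rule measurableI)
  fix A :: "(real ^ 'n) set"
  assume "A \<in> sets borel"
  then show "X i -` A \<inter> space (iterate_sigma P X k) \<in> sets (iterate_sigma P X k)"
    unfolding sets_iterate_sigma space_iterate_sigma using assms by (blast intro: sigma_sets.Basic)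
qed auto

section \<open>Square integrable random vectors and conditional expectation\<close>

lemma integrable_norm_sq_add:
  fixes f g :: "'a \<Rightarrow> 'b::euclidean_space"
  assumes [measurable]: "f \<in> borel_measurable M" "g \<in> borel_measurable M"
    and "integrable M (\<lambda>x. (norm (f x))\<^sup>2)" "integrable M (\<lambda>x. (norm (g x))\<^sup>2)"
  shows "integrable M (\<lambda>x. (norm (f x + g x))\<^sup>2)"
proof (rule Bochner_Integration.integrable_bound)
  show "integrable M (\<lambda>x. 2 * (norm (f x))\<^sup>2 + 2 * (norm (g x))\<^sup>2)"
    using assms by simp
  have "(norm (v + w))\<^sup>2 \<le> 2 * (norm v)\<^sup>2 + 2 * (norm w)\<^sup>2" for v w :: 'b
    using inner_ge_zero[of "v - w"] by (simp add: power2_norm_eq_inner inner_simps inner_commute)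
  then show "AE x in M. norm ((norm (f x + g x))\<^sup>2) \<le> norm (2 * (norm (f x))\<^sup>2 + 2 * (norm (g x))\<^sup>2)"
    by simp
qed simp

lemma integrable_mult_norm_sq:
  fixes f g :: "'a \<Rightarrow> 'b::euclidean_space" and p q :: "'a \<Rightarrow> real"
  assumes [measurable]: "p \<in> borel_measurable M" "q \<in> borel_measurable M"
    and "integrable M (\<lambda>x. (norm (f x))\<^sup>2)" "integrable M (\<lambda>x. (norm (g x))\<^sup>2)"
    and le: "\<And>x. \<bar>p x\<bar> \<le> norm (f x)" "\<And>x. \<bar>q x\<bar> \<le> norm (g x)"
  shows "integrable M (\<lambda>x. p x * q x)"
proof (rule Bochner_Integration.integrable_bound)
  show "integrable M (\<lambda>x. (norm (f x))\<^sup>2 + (norm (g x))\<^sup>2)"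
    using assms by simp
  have "\<bar>p x * q x\<bar> \<le> (norm (f x))\<^sup>2 + (norm (g x))\<^sup>2" for x
  proof -
    have "\<bar>p x * q x\<bar> \<le> norm (f x) * norm (g x)"
      unfolding abs_mult by (intro mult_mono le) auto
    also have "\<dots> \<le> (norm (f x))\<^sup>2 + (norm (g x))\<^sup>2"
      using sum_squares_bound[of "norm (f x)" "norm (g x)"]
        mult_nonneg_nonneg[OF norm_ge_zero[of "f x"] norm_ge_zero[of "g x"]]
      unfolding mult.assoc by linarith
    finally show ?thesis .
  qed
  then show "AE x in M. norm (p x * q x) \<le> norm ((norm (f x))\<^sup>2 + (norm (g x))\<^sup>2)"
    by simp
qed simp

lemma borel_measurable_vec_nth:
  fixes G :: "'a \<Rightarrow> real ^ 'n"
  assumes "G \<in> borel_measurable M"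
  shows "(\<lambda>x. G x $ i) \<in> borel_measurable M"
proof -
  have "(\<lambda>x. G x \<bullet> axis i 1) \<in> borel_measurable M"
    using assms by simp
  then show ?thesis
    by (simp add: inner_axis)
qed

lemma borel_measurable_vec_cond_exp [measurable]:
  fixes G :: "'a \<Rightarrow> real ^ 'n"
  shows
  "vec_cond_exp M F G \<in> borel_measurable F"
proof (subst borel_measurable_euclidean_space, rule ballI)
  fix b :: "real ^ 'n"
  assume "b \<in> Basis"
  then obtain i where "b = axis i 1"
    by (auto simp: Basis_vec_def)
  then show "(\<lambda>x. vec_cond_exp M F G x \<bullet> b) \<in> borel_measurable F"
    by (simp add: vec_cond_exp_def inner_axis)
qed

context finite_measure_subalgebra
begin

text \<open>
  Component by component, \<open>u\<close> times the conditional expectation of \<open>G\<close> has the same mean as \<open>u\<close>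
  times \<open>G\<close>; this needs square integrability of \<open>u\<close> and \<open>G\<close> only.
\<close>

lemma vec_cond_exp_residual_orthogonal:
  fixes u G :: "'a \<Rightarrow> real ^ 'n"
  assumes u: "u \<in> borel_measurable F" and G: "G \<in> borel_measurable M"
    and L2: "integrable M (\<lambda>x. (norm (u x))\<^sup>2)" "integrable M (\<lambda>x. (norm (G x))\<^sup>2)"
  shows "integrable M (\<lambda>x. u x \<bullet> (G x - vec_cond_exp M F G x))"
    and "(\<integral>x. u x \<bullet> (G x - vec_cond_exp M F G x) \<partial>M) = 0"
proof -
  have eq: "u x \<bullet> (G x - vec_cond_exp M F G x)
      = (\<Sum>i\<in>UNIV. u x $ i * G x $ i - u x $ i * real_cond_exp M F (\<lambda>x. G x $ i) x)" for x
    by (simp add: inner_vec_def vec_cond_exp_def right_diff_distrib)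
  have int: "integrable M (\<lambda>x. u x $ i * G x $ i)" for i
    using borel_measurable_vec_nth[OF measurable_from_subalg[OF subalg u]] borel_measurable_vec_nth[OF G]
    by (rule integrable_mult_norm_sq[OF _ _ L2]) (rule component_le_norm_cart)+
  note cond = real_cond_exp_intg[OF int borel_measurable_vec_nth[OF u] borel_measurable_vec_nth[OF G]]
  show "integrable M (\<lambda>x. u x \<bullet> (G x - vec_cond_exp M F G x))"
    unfolding eq using int cond(1) by (intro Bochner_Integration.integrable_sum Bochner_Integration.integrable_diff)
  show "(\<integral>x. u x \<bullet> (G x - vec_cond_exp M F G x) \<partial>M) = 0"
    unfolding eq using int cond
    by (simp add: Bochner_Integration.integral_sum)
qed

lemma integrable_norm_sq_if_nn_cond_exp_le:
  fixes e :: "'a \<Rightarrow> 'b::euclidean_space"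
  assumes [measurable]: "e \<in> borel_measurable M"
    and B: "integrable M B" "\<And>x. 0 \<le> B x"
    and le: "AE x in M. nn_cond_exp M F (\<lambda>x. ennreal ((norm (e x))\<^sup>2)) x \<le> ennreal (B x)"
  shows "integrable M (\<lambda>x. (norm (e x))\<^sup>2)"
    and "(\<integral>x. (norm (e x))\<^sup>2 \<partial>M) \<le> (\<integral>x. B x \<partial>M)"
proof -
  have "(\<integral>\<^sup>+x. ennreal ((norm (e x))\<^sup>2) \<partial>M)
      = (\<integral>\<^sup>+x. nn_cond_exp M F (\<lambda>x. ennreal ((norm (e x))\<^sup>2)) x \<partial>M)"
    using nn_cond_exp_intg[of "\<lambda>_. 1" "\<lambda>x. ennreal ((norm (e x))\<^sup>2)"] by simp
  also have "\<dots> \<le> (\<integral>\<^sup>+x. ennreal (B x) \<partial>M)"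
    by (rule nn_integral_mono_AE[OF le])
  also have "\<dots> = ennreal (\<integral>x. B x \<partial>M)"
    using B by (intro nn_integral_eq_integral) auto
  finally have *: "(\<integral>\<^sup>+x. ennreal ((norm (e x))\<^sup>2) \<partial>M) \<le> ennreal (\<integral>x. B x \<partial>M)" .
  show int: "integrable M (\<lambda>x. (norm (e x))\<^sup>2)"
    using * by (intro integrableI_bounded) (auto simp: le_less_trans)
  show "(\<integral>x. (norm (e x))\<^sup>2 \<partial>M) \<le> (\<integral>x. B x \<partial>M)"
    using * B by (simp add: nn_integral_eq_integral[OF int] ennreal_le_iff)
qed

text \<open>
  A vector that is measurable with respect to the sub-\<open>\<sigma>\<close>-field inherits conditional second moment
  bounds pointwise.
\<close>

lemma norm_le_if_nn_cond_exp_le: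
  assumes "b \<in> borel_measurable F" "\<And>x. 0 \<le> c x"
    and "AE x in M. nn_cond_exp M F (\<lambda>x. ennreal ((norm (b x :: 'b::euclidean_space))\<^sup>2)) x
           \<le> ennreal ((c x)\<^sup>2)"
  shows "AE x in M. norm (b x) \<le> c x"
proof -
  have "AE x in M. ennreal ((norm (b x))\<^sup>2) = nn_cond_exp M F (\<lambda>x. ennreal ((norm (b x))\<^sup>2)) x"
    using assms(1) by (intro nn_cond_exp_F_meas) simp
  with assms(3) show ?thesis
  proof eventually_elim
    case (elim x)
    then have "(norm (b x))\<^sup>2 \<le> (c x)\<^sup>2"
      by (metis ennreal_le_iff zero_le_power2)
    then show ?case
      using assms(2) by (rule power2_le_imp_le)
  qed
qed

text \<open>
  One step of the iteration in mean square, with \<open>y\<close> the displacement from the minimizer, \<open>d\<close> the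
  gradient and \<open>G\<close> its estimate. Besides the contraction, it passes square integrability of \<open>y\<close> on to the
  next step.
\<close>

lemma biased_gradient_step_mean_square:
  fixes y d G :: "'a \<Rightarrow> real ^ 'n"
  defines "h \<equiv> vec_cond_exp M F G"
  assumes y: "y \<in> borel_measurable F" and d: "d \<in> borel_measurable F"
    and G: "G \<in> borel_measurable M" and y2: "integrable M (\<lambda>x. (norm (y x))\<^sup>2)"
    and a: "0 < a" "a * ((2 * \<theta>\<^sup>2 + 2 * \<theta> + 1) * L) \<le> 1" "0 \<le> \<theta>" "0 \<le> m"
    and coco: "\<And>x. (norm (d x))\<^sup>2 \<le> L * (y x \<bullet> d x)"
    and strong: "\<And>x. m * (norm (y x))\<^sup>2 \<le> y x \<bullet> d x"
    and lip: "\<And>x. norm (d x) \<le> L * norm (y x)"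
    and bias: "AE x in M. nn_cond_exp M F (\<lambda>x. ennreal ((norm (h x - d x))\<^sup>2)) x
                 \<le> ennreal (\<theta>\<^sup>2 * (norm (d x))\<^sup>2)"
    and noise: "AE x in M. nn_cond_exp M F (\<lambda>x. ennreal ((norm (G x - h x))\<^sup>2)) x
                 \<le> ennreal (\<theta>\<^sup>2 * (norm (d x))\<^sup>2)"
  shows "integrable M (\<lambda>x. (norm (y x - a *\<^sub>R G x))\<^sup>2)"
    and "(\<integral>x. (norm (y x - a *\<^sub>R G x))\<^sup>2 \<partial>M)
           \<le> (1 - (m - 2 * \<theta> * L) * a) * (\<integral>x. (norm (y x))\<^sup>2 \<partial>M)"
proof -
  define u where "u x = y x - a *\<^sub>R h x" for x
  let ?c = "1 - (m - 2 * \<theta> * L) * a"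
  note [measurable] = G y d
  have h [measurable]: "h \<in> borel_measurable F"
    unfolding h_def by measurable
  have uF: "u \<in> borel_measurable F"
    unfolding u_def by measurable
  note M_meas [measurable] = measurable_from_subalg[OF subalg y] measurable_from_subalg[OF subalg d]
    measurable_from_subalg[OF subalg h] measurable_from_subalg[OF subalg uF]
  have d2: "integrable M (\<lambda>x. (norm (d x))\<^sup>2)"
  proof (rule Bochner_Integration.integrable_bound)
    show "integrable M (\<lambda>x. L\<^sup>2 * (norm (y x))\<^sup>2)"
      using y2 by simp
    show "AE x in M. norm ((norm (d x))\<^sup>2) \<le> norm (L\<^sup>2 * (norm (y x))\<^sup>2)"
      using power_mono[OF lip, of _ 2] by (simp add: power_mult_distrib)
  qed simp
  have e2: "integrable M (\<lambda>x. (norm (G x - h x))\<^sup>2)"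
    and e2_le: "(\<integral>x. (norm (G x - h x))\<^sup>2 \<partial>M) \<le> (\<integral>x. \<theta>\<^sup>2 * (norm (d x))\<^sup>2 \<partial>M)"
    by (rule integrable_norm_sq_if_nn_cond_exp_le[OF _ _ _ noise]; use d2 in simp)+
  have b_le: "AE x in M. norm (h x - d x) \<le> \<theta> * norm (d x)"
    by (rule norm_le_if_nn_cond_exp_le) (use bias a(3) in \<open>simp_all add: power_mult_distrib\<close>)
  then have contract: "AE x in M. (norm (u x))\<^sup>2 + a\<^sup>2 * (\<theta>\<^sup>2 * (norm (d x))\<^sup>2) \<le> ?c * (norm (y x))\<^sup>2"
  proof eventually_elim
    case (elim x)
    then show ?case
      using biased_gradient_step_contracts[OF a coco strong lip elim] by (simp add: u_def)
  qed
  have u2: "integrable M (\<lambda>x. (norm (u x))\<^sup>2)"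
  proof (rule Bochner_Integration.integrable_bound)
    show "integrable M (\<lambda>x. ?c * (norm (y x))\<^sup>2)"
      using y2 by simp
    show "AE x in M. norm ((norm (u x))\<^sup>2) \<le> norm (?c * (norm (y x))\<^sup>2)"
      using contract
    proof eventually_elim
      case (elim x)
      moreover have "0 \<le> a\<^sup>2 * (\<theta>\<^sup>2 * (norm (d x))\<^sup>2)"
        by simp
      ultimately have "(norm (u x))\<^sup>2 \<le> ?c * (norm (y x))\<^sup>2"
        by linarith
      then show ?case
        using abs_ge_self[of "?c * (norm (y x))\<^sup>2"] unfolding real_norm_def abs_of_nonneg[OF zero_le_power2]
        by linarith
    qed
  qed simp
  have "integrable M (\<lambda>x. (norm (h x - d x))\<^sup>2)"
  proof (rule Bochner_Integration.integrable_bound)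
    show "integrable M (\<lambda>x. \<theta>\<^sup>2 * (norm (d x))\<^sup>2)"
      using d2 by simp
    show "AE x in M. norm ((norm (h x - d x))\<^sup>2) \<le> norm (\<theta>\<^sup>2 * (norm (d x))\<^sup>2)"
      using b_le
    proof eventually_elim
      case (elim x)
      from power_mono[OF this, of 2] show ?case
        by (simp add: power_mult_distrib)
    qed
  qed simp
  from integrable_norm_sq_add[OF _ _ this d2] have "integrable M (\<lambda>x. (norm (h x))\<^sup>2)"
    by simp
  from integrable_norm_sq_add[OF _ _ e2 this] have G2: "integrable M (\<lambda>x. (norm (G x))\<^sup>2)"
    by simp
  note orth = vec_cond_exp_residual_orthogonal[OF uF G u2 G2, folded h_def]
  have expand: "(norm (y x - a *\<^sub>R G x))\<^sup>2
      = (norm (u x))\<^sup>2 - 2 * a * (u x \<bullet> (G x - h x)) + a\<^sup>2 * (norm (G x - h x))\<^sup>2" for x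
  proof -
    have "y x - a *\<^sub>R G x = u x - a *\<^sub>R (G x - h x)"
      by (simp add: u_def algebra_simps)
    moreover have "(norm (v - a *\<^sub>R w))\<^sup>2 = (norm v)\<^sup>2 - 2 * a * (v \<bullet> w) + a\<^sup>2 * (norm w)\<^sup>2"
      for v w :: "real ^ 'n"
      unfolding power2_norm_eq_inner
      by (simp add: inner_simps inner_commute power2_eq_square algebra_simps)
    ultimately show ?thesis
      by simp
  qed
  show "integrable M (\<lambda>x. (norm (y x - a *\<^sub>R G x))\<^sup>2)"
    unfolding expand using u2 orth(1) e2 by simp
  have "(\<integral>x. (norm (y x - a *\<^sub>R G x))\<^sup>2 \<partial>M)
      = (\<integral>x. (norm (u x))\<^sup>2 \<partial>M) + a\<^sup>2 * (\<integral>x. (norm (G x - h x))\<^sup>2 \<partial>M)"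
    unfolding expand using u2 orth e2 by simp
  also have "\<dots> \<le> (\<integral>x. (norm (u x))\<^sup>2 \<partial>M) + a\<^sup>2 * (\<integral>x. \<theta>\<^sup>2 * (norm (d x))\<^sup>2 \<partial>M)"
    by (intro add_left_mono mult_left_mono e2_le) simp
  also have "\<dots> = (\<integral>x. (norm (u x))\<^sup>2 + a\<^sup>2 * (\<theta>\<^sup>2 * (norm (d x))\<^sup>2) \<partial>M)"
    using u2 d2 by simp
  also have "\<dots> \<le> (\<integral>x. ?c * (norm (y x))\<^sup>2 \<partial>M)"
    using u2 d2 y2 by (intro integral_mono_AE contract) simp_all
  also have "\<dots> = ?c * (\<integral>x. (norm (y x))\<^sup>2 \<partial>M)"
    by simp
  finally show "(\<integral>x. (norm (y x - a *\<^sub>R G x))\<^sup>2 \<partial>M) \<le> ?c * (\<integral>x. (norm (y x))\<^sup>2 \<partial>M)" .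
qed

end

section \<open>Linear convergence of the iteration\<close>

theorem theorem4p1:
  fixes F :: "real ^ 'n \<Rightarrow> real"
    and M m \<theta> a :: real
    and x0 xstar :: "real ^ 'n"
    and P :: "'w measure"
    and g :: "nat \<Rightarrow> real ^ 'n \<Rightarrow> 'w \<Rightarrow> real ^ 'n"
    and X :: "nat \<Rightarrow> 'w \<Rightarrow> real ^ 'n"
    and step :: "nat \<Rightarrow> real"
  assumes "times_cont_differentiable 5 F"
    and "\<forall>x. deriv_tensor_nonzero 5 F x"
    and "M > 0" and "m > 0"
    and "\<forall>x1 x2. norm (gradient F x1 - gradient F x2) \<le> M * norm (x1 - x2)"
    and "\<forall>x. smallest_eigenvalue (hessian F x) \<ge> m"
    and "\<forall>x. is_arg_min F (\<lambda>_. True) x \<longleftrightarrow> x = xstar"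
    and "prob_space P"
    and "\<forall>k. (\<lambda>\<omega>. g k (X k \<omega>) \<omega>) \<in> borel_measurable P"
    and "\<forall>\<omega>\<in>space P. X 0 \<omega> = x0"
    and "\<forall>k. \<forall>\<omega>\<in>space P. X (Suc k) \<omega> = X k \<omega> - step k *\<^sub>R g k (X k \<omega>) \<omega>"
    and "0 < \<theta>" and "\<theta> < m / (2 * M)"
    and "\<forall>k. AE \<omega> in P.
           max (nn_cond_exp P (iterate_sigma P X k) (\<lambda>\<omega>. ennreal ((norm (cond_bias P F g X k \<omega>))\<^sup>2)) \<omega>)
               (nn_cond_exp P (iterate_sigma P X k) (\<lambda>\<omega>. ennreal ((norm (grad_noise P g X k \<omega>))\<^sup>2)) \<omega>)
           \<le> ennreal (\<theta>\<^sup>2 * (norm (gradient F (X k \<omega>)))\<^sup>2)"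
    and "\<forall>k. 0 < step k \<and> step k = a \<and> a \<le> 1 / ((2 * \<theta>\<^sup>2 + 2 * \<theta> + 1) * M)"
  shows "\<forall>k. integrable P (\<lambda>\<omega>. (norm (X k \<omega> - xstar))\<^sup>2) \<and>
             prob_space.expectation P (\<lambda>\<omega>. (norm (X k \<omega> - xstar))\<^sup>2)
               \<le> (1 - (m - 2 * \<theta> * M) * a) ^ k * (norm (x0 - xstar))\<^sup>2"
proof -
  interpret prob_space P
    by fact
  define DF where "DF = gradient F"
  let ?c = "1 - (m - 2 * \<theta> * M) * a"
  have F2: "times_cont_differentiable 2 F"
    by (rule times_cont_differentiable_mono[OF assms(1)]) simp
  have grad: "GDERIV F x :> DF x" for x
    unfolding DF_def using times_cont_differentiableD(1)[OF F2, of "[]"] by (intro GDERIV_gradient) simp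
  have lip: "norm (DF x - DF y) \<le> M * norm (x - y)" for x y
    using assms(5) by (simp add: DF_def)
  have strong: "m * (norm (x - y))\<^sup>2 \<le> (x - y) \<bullet> (DF x - DF y)" for x y
    unfolding DF_def using assms(6) by (intro strongly_monotone_gradient[OF F2]) simp
  have mono: "0 \<le> (x - y) \<bullet> (DF x - DF y)" for x y
    using order_trans[OF _ strong[of x y], of 0] \<open>m > 0\<close> by simp
  note coco = cocoercive_gradient[OF grad mono lip \<open>M > 0\<close>]
  have "F xstar \<le> F y" for y
    using assms(7) by (metis is_arg_min_def linorder_not_le)
  then have "(\<lambda>h. h \<bullet> DF xstar) = (\<lambda>h. 0)"
    using grad[of xstar] unfolding gderiv_def
    by (intro differential_zero_maxmin[of xstar UNIV F]) auto
  then have crit: "DF xstar = 0"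
    by (metis inner_eq_zero_iff)
  have a: "0 < a" "a * ((2 * \<theta>\<^sup>2 + 2 * \<theta> + 1) * M) \<le> 1" "0 \<le> \<theta>" "0 \<le> m" and stp: "step k = a" for k
  proof -
    have "0 < (2 * \<theta>\<^sup>2 + 2 * \<theta> + 1) * M"
      using \<open>0 < \<theta>\<close> \<open>M > 0\<close> by (intro mult_pos_pos add_nonneg_pos) auto
    then show "a * ((2 * \<theta>\<^sup>2 + 2 * \<theta> + 1) * M) \<le> 1"
      using assms(15) by (simp add: pos_le_divide_eq)
  qed (use assms in auto)
  \<comment> \<open>Strong monotonicity against the Lipschitz bound in a unit direction forces \<open>m \<le> M\<close>; since
    \<open>a M \<le> 1\<close>, the contraction factor is nonnegative and may be multiplied with the induction
    hypothesis.\<close>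
  have c: "0 \<le> ?c"
  proof -
    obtain v :: "real ^ 'n" where v: "norm v = 1"
      using vector_choose_size[of 1] by auto
    have "m \<le> v \<bullet> (DF (xstar + v) - DF xstar)"
      using strong[of "xstar + v" xstar] v by simp
    also have "\<dots> \<le> M"
      using norm_cauchy_schwarz[of v "DF (xstar + v) - DF xstar"] lip[of "xstar + v" xstar] v by simp
    finally have "m \<le> M" .
    moreover have "0 \<le> 2 * \<theta> * M"
      using a(3) \<open>M > 0\<close> by simp
    ultimately have "m - 2 * \<theta> * M \<le> M"
      by linarith
    then have "(m - 2 * \<theta> * M) * a \<le> M * a"
      using a(1) by (intro mult_right_mono) auto
    also have "\<dots> \<le> a * ((2 * \<theta>\<^sup>2 + 2 * \<theta> + 1) * M)"
      using a \<open>M > 0\<close> by (simp add: algebra_simps)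
    finally show ?thesis
      using a(2) by linarith
  qed
  \<comment> \<open>The initial point is not among the generators of the \<open>\<sigma>\<close>-fields, but it is constant.\<close>
  have X0: "X 0 \<in> borel_measurable N" if "space N = space P" for N
    using assms(10) that by (subst measurable_cong[where g = "\<lambda>_. x0"]) auto
  have X: "X k \<in> borel_measurable P" for k
  proof (induction k)
    case (Suc k)
    have "(\<lambda>\<omega>. X k \<omega> - a *\<^sub>R g k (X k \<omega>) \<omega>) \<in> borel_measurable P"
      by (intro borel_measurable_diff borel_measurable_scaleR borel_measurable_const Suc assms(9)[rule_format])
    then show ?case
      using assms(11) stp by (subst measurable_cong) auto
  qed (simp add: X0)
  have XS: "X k \<in> borel_measurable (iterate_sigma P X k)" for k
    by (cases k) (simp_all add: X0 iterate_measurable_iterate_sigma)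
  have "continuous_on UNIV DF"
    using gradient_has_derivative_hessian[OF F2] has_derivative_continuous
    unfolding DF_def continuous_on_eq_continuous_at[OF open_UNIV] by blast
  then have [measurable]: "DF \<in> borel_measurable borel"
    by (rule borel_measurable_continuous_onI)
  have "integrable P (\<lambda>\<omega>. (norm (X k \<omega> - xstar))\<^sup>2) \<and>
        expectation (\<lambda>\<omega>. (norm (X k \<omega> - xstar))\<^sup>2) \<le> ?c ^ k * (norm (x0 - xstar))\<^sup>2" for k
  proof (induction k)
    case 0
    have "has_bochner_integral P (\<lambda>\<omega>. (norm (X 0 \<omega> - xstar))\<^sup>2) ((norm (x0 - xstar))\<^sup>2)
        \<longleftrightarrow> has_bochner_integral P (\<lambda>\<omega>. (norm (x0 - xstar))\<^sup>2) ((norm (x0 - xstar))\<^sup>2)"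
      by (rule has_bochner_integral_cong) (simp_all add: assms(10))
    moreover have "has_bochner_integral P (\<lambda>\<omega>. (norm (x0 - xstar))\<^sup>2) ((norm (x0 - xstar))\<^sup>2)"
      by (simp add: has_bochner_integral_iff prob_space)
    ultimately show ?case
      by (simp add: has_bochner_integral_iff)
  next
    case (Suc k)
    let ?S = "iterate_sigma P X k" and ?G = "\<lambda>\<omega>. g k (X k \<omega>) \<omega>"
    interpret S: finite_measure_subalgebra P ?S
      by unfold_locales (rule subalgebra_iterate_sigma[OF X])
    have bias: "AE \<omega> in P. nn_cond_exp P ?S
          (\<lambda>\<omega>. ennreal ((norm (vec_cond_exp P ?S ?G \<omega> - DF (X k \<omega>)))\<^sup>2)) \<omega>
          \<le> ennreal (\<theta>\<^sup>2 * (norm (DF (X k \<omega>)))\<^sup>2)"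
      and noise: "AE \<omega> in P. nn_cond_exp P ?S
          (\<lambda>\<omega>. ennreal ((norm (?G \<omega> - vec_cond_exp P ?S ?G \<omega>))\<^sup>2)) \<omega>
          \<le> ennreal (\<theta>\<^sup>2 * (norm (DF (X k \<omega>)))\<^sup>2)"
      using assms(14)[rule_format, of k]
      by (auto simp: cond_bias_def grad_noise_def DF_def elim: eventually_mono)
    have upd: "X (Suc k) \<omega> - xstar = X k \<omega> - xstar - a *\<^sub>R ?G \<omega>" if "\<omega> \<in> space P" for \<omega>
      using assms(11) that stp by simp
    have "(\<lambda>\<omega>. X k \<omega> - xstar) \<in> borel_measurable ?S" "(\<lambda>\<omega>. DF (X k \<omega>)) \<in> borel_measurable ?S"
      using XS[of k] by measurable
    note one_step = S.biased_gradient_step_mean_square[OF this assms(9)[rule_format]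
        conjunct1[OF Suc] a _ _ _ bias noise]
    have step: "integrable P (\<lambda>\<omega>. (norm (X k \<omega> - xstar - a *\<^sub>R ?G \<omega>))\<^sup>2)"
      "expectation (\<lambda>\<omega>. (norm (X k \<omega> - xstar - a *\<^sub>R ?G \<omega>))\<^sup>2)
         \<le> ?c * expectation (\<lambda>\<omega>. (norm (X k \<omega> - xstar))\<^sup>2)"
      by (rule one_step; use coco[of _ xstar] strong[of _ xstar] lip[of _ xstar] crit in simp)+
    have "integrable P (\<lambda>\<omega>. (norm (X (Suc k) \<omega> - xstar))\<^sup>2)"
      using step(1) by (rule Bochner_Integration.integrable_cong[THEN iffD1, rotated 2]) (simp_all add: upd)
    moreover have "expectation (\<lambda>\<omega>. (norm (X (Suc k) \<omega> - xstar))\<^sup>2)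
        = expectation (\<lambda>\<omega>. (norm (X k \<omega> - xstar - a *\<^sub>R ?G \<omega>))\<^sup>2)"
      by (rule Bochner_Integration.integral_cong) (simp_all add: upd)
    moreover have "?c * expectation (\<lambda>\<omega>. (norm (X k \<omega> - xstar))\<^sup>2)
        \<le> ?c * (?c ^ k * (norm (x0 - xstar))\<^sup>2)"
      using Suc c by (intro mult_left_mono) auto
    ultimately show ?case
      using step(2) by (simp add: mult.assoc)
  qed
  then show ?thesis
    by blast
qed

end
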